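(* Let $S$ be a nontrivial proper subgroup of $\mathbb{Q}$, let $u,v\in\mathbb{N}$, and let $A$ be a $u\times v$ matrix with rational entries that is weakly image partition regular over $S$ and has linearly dependent rows. Then there exist $j<u$ and a $(j+u)\times 3u$ matrix $D$ (with rational entries) that is kernel partition regular over $S$ such that, whenever $\vec s\in(S\setminus\{0\})^{3u}$ and $D\vec s=\vec 0$, there exists $\vec y\in S^v\setminus\{\vec 0\}$ such that all entries of $A\vec y$ are entries of $\vec s$.
   Context: $\mathbb{N}$ is the set of positive integers; nontrivial means $\neq\{0\}$. A finite colouring is a function with finite range; monochromatic means constant colour. $A$ is weakly image partition regular over $S$ (a group) if for every finite colouring of $S\setminus\{0\}$ there is $\vec x\in S^v$ with the entries of $A\vec x$ in $S\setminus\{0\}$ and monochromatic. A matrix $M$ with $w$ columns is kernel partition regular over $S$ if for every finite colouring of $S\setminus\{0\}$ there is $\vec x\in(S\setminus\{0\})^w$ with $M\vec x=\vec 0$ and the entries of $\vec x$ monochromatic. *)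

theory Defs
  imports "Jordan_Normal_Form.VS_Connect" "HOL-Algebra.AbelCoset"
begin

definition vecs_over :: "rat set \<Rightarrow> nat \<Rightarrow> rat vec set" where
  "vecs_over T n = {x \<in> carrier_vec n. set\<^sub>v x \<subseteq> T}"

text \<open>Only the restriction of the colouring to the set in question matters; since its range there
  is finite, natural numbers suffice as colours.\<close>

definition finite_colouring :: "(rat \<Rightarrow> nat) \<Rightarrow> rat set \<Rightarrow> bool" where
  "finite_colouring c T \<longleftrightarrow> finite (c ` T)"

definition monochromatic :: "(rat \<Rightarrow> nat) \<Rightarrow> rat set \<Rightarrow> bool" where
  "monochromatic c T \<longleftrightarrow> (\<exists>k. \<forall>t\<in>T. c t = k)"

definition weakly_image_partition_regular :: "rat mat \<Rightarrow> rat set \<Rightarrow> bool" where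
  "weakly_image_partition_regular A S \<longleftrightarrow>
     (\<forall>c. finite_colouring c (S - {0}) \<longrightarrow>
       (\<exists>x \<in> vecs_over S (dim_col A).
          set\<^sub>v (A *\<^sub>v x) \<subseteq> S - {0} \<and> monochromatic c (set\<^sub>v (A *\<^sub>v x))))"

definition kernel_partition_regular :: "rat mat \<Rightarrow> rat set \<Rightarrow> bool" where
  "kernel_partition_regular M S \<longleftrightarrow>
     (\<forall>c. finite_colouring c (S - {0}) \<longrightarrow>
       (\<exists>x \<in> vecs_over (S - {0}) (dim_col M).
          M *\<^sub>v x = 0\<^sub>v (dim_row M) \<and> monochromatic c (set\<^sub>v x)))"

text \<open>Dependence of the rows as an indexed family: a repeated row makes the rows dependent,
  which dependence of the set of rows would not capture.\<close>

definition rows_linearly_dependent :: "rat mat \<Rightarrow> bool" where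
  "rows_linearly_dependent A \<longleftrightarrow>
     (\<exists>a. (\<exists>i<dim_row A. a i \<noteq> 0) \<and>
          (\<forall>k<dim_col A. (\<Sum>i<dim_row A. a i * A $$ (i, k)) = 0))"

end

theory Submission
  imports Defs "HOL-Library.Function_Algebras" "HOL-Library.Countable"
begin

text \<open>
  Let \<open>B\<close> be a generalised inverse of \<open>A\<close>, i.e. \<open>A B A = A\<close>. The kernel of \<open>1 - A B\<close> is the
  column space of \<open>A\<close>, and since \<open>A \<noteq> 0\<close> one row of \<open>1 - A B\<close> is redundant; deleting it gives
  \<open>N\<close> with \<open>j = u - 1\<close> rows. If \<open>d B\<close> is an integer matrix, let \<open>D\<close> express, for
  \<open>s = (a, b, c)\<close>, that \<open>N a = 0\<close> and \<open>a = d (b - c)\<close>. Then \<open>y = B a = d B (b - c)\<close> lies in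
  \<open>S\<^sup>v\<close> and \<open>A y = a\<close>.

  For partition regularity of \<open>D\<close>, compactness gives a finite \<open>F\<close> such that every colouring of
  \<open>F\<close> with the given number of colours has a monochromatic image of \<open>A\<close>. Colour a positive
  integer \<open>n\<close> by the colours of all \<open>n f\<close> with \<open>f \<in> F\<close>, and find \<open>x\<close>, \<open>x + t\<close>, \<open>d t\<close> of one colour.
  A monochromatic image \<open>a\<close> for the colouring \<open>f \<mapsto> c (x f)\<close> then yields the monochromatic
  solution \<open>(d t a, (x + t) a, x a)\<close>.
\<close>

section \<open>Compactness for finite colourings\<close>

text \<open>If every initial segment of an enumeration of \<open>X\<close> had a bad colouring, a
  diagonal choice of indices would give a limit colouring of \<open>X\<close>. Its monochromatic
  member of \<open>\<A>\<close> is finite, so some bad colouring agrees with the limit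
  there.\<close>

lemma colouring_compactness:
  fixes X :: "'a::countable set" and r :: nat
  assumes fin: "\<And>E. E \<in> \<A> \<Longrightarrow> finite E \<and> E \<subseteq> X"
    and mono: "\<And>c. c ` X \<subseteq> {..<r} \<Longrightarrow> \<exists>E\<in>\<A>. \<exists>k. \<forall>e\<in>E. c e = k"
  obtains F where "finite F" "F \<subseteq> X"
    "\<And>c. c ` F \<subseteq> {..<r} \<Longrightarrow> \<exists>E\<in>\<A>. E \<subseteq> F \<and> (\<exists>k. \<forall>e\<in>E. c e = k)"
proof (rule ccontr)
  assume contra: "\<not> thesis"
  define F where "F n = {x\<in>X. to_nat x < n}" for n
  have F: "finite (F n)" "F n \<subseteq> X" for n
    unfolding F_def by (auto intro!: finite_imageD[where f = to_nat] finite_subset[of _ "{..<n}"] simp: inj_on_def)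
  have "\<exists>c. c ` F n \<subseteq> {..<r} \<and> \<not> (\<exists>E\<in>\<A>. E \<subseteq> F n \<and> (\<exists>k. \<forall>e\<in>E. c e = k))" for n
  proof (rule ccontr)
    assume none: "\<not> ?thesis"
    show False
      by (rule notE[OF contra], rule that[OF F(1)[of n] F(2)[of n]]) (use none in blast)
  qed
  then obtain c where c: "\<And>n. c n ` F n \<subseteq> {..<r}"
    and bad: "\<And>n. \<not> (\<exists>E\<in>\<A>. E \<subseteq> F n \<and> (\<exists>k. \<forall>e\<in>E. c n e = k))"
    by metis
  \<comment> \<open>Stage \<open>n\<close> thins the index set \<open>I\<close> to \<open>J\<close>
    so that the point numbered \<open>n\<close>, if there is one, gets the same colour from all
    remaining colourings.\<close>
  define Q where "Q n I J \<longleftrightarrow> J \<subseteq> I \<and>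
      (\<forall>x\<in>X. to_nat x = n \<longrightarrow> (\<exists>k<r. \<forall>m\<in>J. c m x = k))"
    for n :: nat and I J :: "nat set"
  have "\<exists>I. \<forall>n. infinite (I n) \<and> Q n (I n) (I (Suc n))"
  proof (rule dependent_nat_choice)
    show "\<exists>I::nat set. infinite I"
      using infinite_UNIV_nat by blast
  next
    fix I :: "nat set" and n
    assume I: "infinite I"
    show "\<exists>J. infinite J \<and> Q n I J"
    proof (cases "\<exists>x\<in>X. to_nat x = n")
      case False
      with I show ?thesis by (auto simp: Q_def)
    next
      case True
      then obtain x where x: "x \<in> X" "to_nat x = n" by blast
      \<comment> \<open>Only on \<open>F m\<close> are the colours of \<open>c m\<close> bounded by
        \<open>r\<close>, and the point numbered \<open>n\<close> lies in \<open>F m\<close> only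
        for \<open>m > n\<close>.\<close>
      define I' where "I' = I - {..n}"
      have I': "infinite I'" using I by (simp add: I'_def)
      have "x \<in> F m" if "m \<in> I'" for m
        using that x by (auto simp: F_def I'_def)
      then have "(\<lambda>m. c m x) ` I' \<subseteq> {..<r}" using c by blast
      then have fin_img: "finite ((\<lambda>m. c m x) ` I')" by (rule finite_subset) simp
      obtain m0 where m0: "m0 \<in> I'" "infinite {m\<in>I'. c m x = c m0 x}"
        using pigeonhole_infinite[OF I' fin_img] by blast
      have "c m0 x < r" using m0 \<open>(\<lambda>m. c m x) ` I' \<subseteq> {..<r}\<close> by auto
      then have "Q n I {m\<in>I'. c m x = c m0 x}"
        using x by (auto simp: Q_def I'_def intro!: exI[of _ "c m0 x"])
      with m0 show ?thesis by blast
    qed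
  qed
  then obtain I where I: "\<And>n. infinite (I n)" "\<And>n. Q n (I n) (I (Suc n))" by blast
  have dec: "I n \<subseteq> I m" if "m \<le> n" for m n
    using that I(2) by (induction n rule: dec_induct) (auto simp: Q_def)
  have "\<forall>x\<in>X. \<exists>k<r. \<forall>m\<in>I (Suc (to_nat x)). c m x = k"
    using I(2) by (auto simp: Q_def)
  then obtain g where g: "\<And>x. x \<in> X \<Longrightarrow> g x < r"
    "\<And>x m. x \<in> X \<Longrightarrow> m \<in> I (Suc (to_nat x)) \<Longrightarrow> c m x = g x"
    by metis
  obtain E k where E: "E \<in> \<A>" "\<And>e. e \<in> E \<Longrightarrow> g e = k"
    using mono[of g] g(1) by (metis image_subsetI lessThan_iff)
  have fE: "finite E" "E \<subseteq> X" using fin E(1) by auto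
  obtain n where n: "\<And>e. e \<in> E \<Longrightarrow> to_nat e < n"
    using finite_nat_set_iff_bounded[of "to_nat ` E"] fE by auto
  \<comment> \<open>Membership in \<open>I n\<close> makes \<open>c m\<close> agree with
    \<open>g\<close> on \<open>E\<close>; \<open>m > n\<close> puts \<open>E\<close> inside
    \<open>F m\<close>.\<close>
  obtain m where m: "m \<in> I n" "m > n"
    using I(1) infinite_nat_iff_unbounded by blast
  have "c m e = k" if "e \<in> E" for e
    using g(2)[of e m] dec[of "Suc (to_nat e)" n] n[OF that] m that fE E(2) by auto
  moreover have "E \<subseteq> F m" using n m fE by (force simp: F_def)
  ultimately have "E \<subseteq> F m \<and> (\<exists>k. \<forall>e\<in>E. c m e = k)" by blast
  with bad[of m] E(1) show False by (meson bexI)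
qed

section \<open>A monochromatic pattern x, x + t, d t\<close>

text \<open>Choose a minimal set \<open>K\<close> of colours that suffices for arbitrarily long intervals; by minimality
  each colour of \<open>K\<close> has bounded gaps in them. Build \<open>s\<close> such that every \<open>d (s\<^sub>j - s\<^sub>i)\<close> has
  a colour in \<open>K\<close>. Inside one long interval, pigeonhole on the distances from \<open>b + s\<^sub>j\<close> to the next
  occurrence of each colour makes \<open>t = s\<^sub>j - s\<^sub>i\<close> a difference of every colour of \<open>K\<close> at once,
  in particular of the colour of \<open>d t\<close>.\<close>

lemma finite_colouring_dilated_difference:
  fixes c :: "nat \<Rightarrow> 'b" and d :: nat
  assumes fin: "finite (c ` {0<..})" and d: "d > 0"
  obtains x t where "x > 0" "t > 0" "c (x + t) = c x" "c (d * t) = c x"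
proof -
  define thick where "thick K \<longleftrightarrow> (\<forall>n. \<exists>a>0. c ` {a..<a+n} \<subseteq> K)" for K
  have "thick (c ` {0<..})"
    unfolding thick_def by (intro allI exI[of _ 1]) auto
  moreover have "finite {K. K \<subseteq> c ` {0<..} \<and> thick K}"
    using fin by simp
  ultimately have "\<exists>K\<in>{K. K \<subseteq> c ` {0<..} \<and> thick K}. K \<subseteq> c ` {0<..} \<and>
      (\<forall>K'\<in>{K. K \<subseteq> c ` {0<..} \<and> thick K}. K' \<subseteq> K \<longrightarrow> K = K')"
    by (intro finite_has_minimal2) auto
  then obtain K where K: "K \<subseteq> c ` {0<..}" "thick K"
    and minimal: "\<And>K'. K' \<subseteq> c ` {0<..} \<Longrightarrow> thick K' \<Longrightarrow> K' \<subseteq> K \<Longrightarrow> K = K'"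
    by auto
  have finK: "finite K" using K(1) fin finite_subset by blast
  \<comment> \<open>If \<open>k\<close> were missing from arbitrarily long intervals coloured by
    \<open>K\<close>, then \<open>K - {k}\<close> would be thick.\<close>
  have "\<forall>k\<in>K. \<exists>n. \<forall>a>0. c ` {a..<a+n} \<subseteq> K \<longrightarrow> k \<in> c ` {a..<a+n}"
  proof
    fix k assume "k \<in> K"
    then have "\<not> thick (K - {k})" using minimal[of "K - {k}"] K(1) by blast
    then obtain n where n: "\<And>a. a > 0 \<Longrightarrow> \<not> c ` {a..<a+n} \<subseteq> K - {k}"
      unfolding thick_def by metis
    show "\<exists>n. \<forall>a>0. c ` {a..<a+n} \<subseteq> K \<longrightarrow> k \<in> c ` {a..<a+n}"
    proof (intro exI[of _ n] allI impI)
      fix a :: nat assume "a > 0" "c ` {a..<a+n} \<subseteq> K"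
      then show "k \<in> c ` {a..<a+n}" using n[of a] by (metis subset_Diff_insert Diff_empty)
    qed
  qed
  then obtain l where l: "\<And>k a. k \<in> K \<Longrightarrow> a > 0 \<Longrightarrow> c ` {a..<a+l k} \<subseteq> K \<Longrightarrow> k \<in> c ` {a..<a+l k}"
    by metis
  define L where "L = Max (insert 0 (l ` K))"
  have lL: "l k \<le> L" if "k \<in> K" for k using that finK by (simp add: L_def)
  have synd: "\<exists>p<L. c (a + p) = k" if "k \<in> K" "a > 0" "c ` {a..<a+L} \<subseteq> K" for k a
  proof -
    have "c ` {a..<a+l k} \<subseteq> K" using that(3) lL[OF that(1)] by (force simp: image_subset_iff)
    from l[OF that(1,2) this] obtain q where "q \<in> {a..<a+l k}" "c q = k" by blast
    then show ?thesis using lL[OF that(1)] by (intro exI[of _ "q - a"]) auto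
  qed
  have "\<exists>A>0. \<forall>t\<in>{A..A+m}. c (d * t) \<in> K" for m
  proof -
    \<comment> \<open>Room for \<open>m + 1\<close> consecutive multiples of \<open>d\<close>, with
      slack for rounding \<open>a\<close> up to a multiple.\<close>
    obtain a where a: "a > 0" "c ` {a..<a + d * (m + 2)} \<subseteq> K"
      using K(2) unfolding thick_def by blast
    define A where "A = a div d + 1"
    have A: "a < d * A" "d * A \<le> a + d"
      using d by (auto simp: A_def algebra_simps dividend_less_times_div)
    have "c (d * t) \<in> K" if t: "t \<in> {A..A+m}" for t
    proof -
      have "d * A \<le> d * t" "d * t \<le> d * (A + m)" using t by auto
      then have "a \<le> d * t" "d * t < a + d * (m + 2)"
        using A d unfolding distrib_left by linarith+
      then have "d * t \<in> {a..<a + d * (m + 2)}" by simp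
      with a show ?thesis by blast
    qed
    then show ?thesis by (intro exI[of _ A]) (auto simp: A_def)
  qed
  then obtain A where A: "\<And>m. A m > 0" "\<And>m t. t \<in> {A m..A m+m} \<Longrightarrow> c (d * t) \<in> K"
    by metis
  \<comment> \<open>With this recursion \<open>s (Suc j') - s i\<close> lies in
    \<open>{A (s j')..A (s j') + s j'}\<close> for all \<open>i \<le> j'\<close>, so one choice of
    \<open>A\<close> handles every earlier \<open>i\<close>.\<close>
  define s where "s = rec_nat 0 (\<lambda>_ m. m + A m)"
  have s_Suc: "s (Suc i) = s i + A (s i)" for i by (simp add: s_def)
  have s: "strict_mono s" using A(1) by (auto simp: strict_mono_Suc_iff s_Suc)
  have diff: "c (d * (s j - s i)) \<in> K" if ij: "i < j" for i j
  proof -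
    obtain j' where j: "j = Suc j'" using ij by (cases j) auto
    then have "s i \<le> s j'" using s ij by (simp add: strict_mono_less_eq)
    then show ?thesis by (intro A(2)[of _ "s j'"]) (auto simp: j s_Suc)
  qed
  \<comment> \<open>The number of possible offset functions, so two of the \<open>Q + 1\<close>
    windows starting at \<open>b + s j\<close> share one.\<close>
  define Q where "Q = card (K \<rightarrow>\<^sub>E {..<L})"
  obtain b where b: "b > 0" "c ` {b..<b + (s Q + L)} \<subseteq> K"
    using K(2) unfolding thick_def by blast
  have "\<forall>j\<in>{..Q}. \<exists>\<phi>\<in>K \<rightarrow>\<^sub>E {..<L}. \<forall>k\<in>K. c (b + s j + \<phi> k) = k"
  proof
    fix j assume "j \<in> {..Q}"
    then have "s j \<le> s Q" using s by (simp add: strict_mono_less_eq)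
    then have "c ` {b + s j..<b + s j + L} \<subseteq> K" using b(2) by (force simp: image_subset_iff)
    then have "\<forall>k\<in>K. \<exists>p. p < L \<and> c (b + s j + p) = k"
      using synd[of _ "b + s j"] b(1) by blast
    then obtain \<phi> where \<phi>: "\<And>k. k \<in> K \<Longrightarrow> \<phi> k < L \<and> c (b + s j + \<phi> k) = k" by metis
    show "\<exists>\<phi>\<in>K \<rightarrow>\<^sub>E {..<L}. \<forall>k\<in>K. c (b + s j + \<phi> k) = k"
      using \<phi> by (intro bexI[of _ "restrict \<phi> K"]) auto
  qed
  then obtain \<phi> where \<phi>: "\<And>j. j \<in> {..Q} \<Longrightarrow> \<phi> j \<in> K \<rightarrow>\<^sub>E {..<L}"
    "\<And>j k. j \<in> {..Q} \<Longrightarrow> k \<in> K \<Longrightarrow> c (b + s j + \<phi> j k) = k"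
    by metis
  have "\<phi> ` {..Q} \<subseteq> K \<rightarrow>\<^sub>E {..<L}" using \<phi>(1) by blast
  then have "card (\<phi> ` {..Q}) \<le> card (K \<rightarrow>\<^sub>E {..<L})"
    using finK by (intro card_mono finite_PiE) auto
  then have "card (\<phi> ` {..Q}) \<le> Q" by (simp add: Q_def)
  then have "\<not> inj_on \<phi> {..Q}" by (intro pigeonhole) simp
  then obtain i j where ij: "i < j" "j \<le> Q" "\<phi> i = \<phi> j"
    unfolding inj_on_def by (metis atMost_iff linorder_neqE_nat)
  define t where "t = s j - s i"
  \<comment> \<open>The shared offset for \<open>k\<close> gives two numbers of colour
    \<open>k\<close> at distance \<open>t\<close>.\<close>
  define k where "k = c (d * t)"
  have "s i < s j" using s ij(1) by (simp add: strict_mono_less)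
  moreover have "k \<in> K" using diff[OF ij(1)] by (simp add: k_def t_def)
  ultimately show ?thesis
    using \<phi>(2)[of i k] \<phi>(2)[of j k] ij b(1)
    by (intro that[of "b + s i + \<phi> i k" t]) (auto simp: k_def[symmetric] t_def[symmetric] add_ac, auto simp: t_def)
qed

section \<open>Rational matrices: denominators, generalised inverses, column spaces\<close>

lemma common_denominator:
  fixes X :: "rat set"
  assumes "finite X"
  obtains d :: nat where "d > 0" "\<And>x. x \<in> X \<Longrightarrow> of_nat d * x \<in> \<int>"
proof -
  have "\<exists>d::nat. d > 0 \<and> (\<forall>x\<in>X. of_nat d * x \<in> \<int>)"
    using assms
  proof induction
    case empty
    then show ?case by blast
  next
    case (insert x X)
    then obtain d :: nat where d: "d > 0" "\<forall>x\<in>X. of_nat d * x \<in> \<int>" by blast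
    obtain p q :: int where pq: "x = of_int p / of_int q" "q > 0"
      by (metis quotient_of_div quotient_of_denom_pos surj_pair)
    have q: "(of_nat (nat q) :: rat) = of_int q" using pq by simp
    have "of_nat (d * nat q) * x = of_int (int d * p)" using pq q by simp
    moreover have "of_nat (d * nat q) * z \<in> \<int>" if "z \<in> X" for z
    proof -
      have "of_nat (d * nat q) * z = of_int q * (of_nat d * z)" by (simp add: q)
      then show ?thesis using d that by (simp only: Ints_mult Ints_of_int)
    qed
    ultimately show ?case using d pq
      by (intro exI[of _ "d * nat q"]) (auto simp del: of_nat_mult)
  qed
  then show ?thesis using that by blast
qed

text \<open>A linear map has a linear right inverse on its range; \<open>B\<close> is the matrix of
  this inverse, cut down to the relevant coordinates.\<close>

lemma generalised_inverse_exists: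
  fixes A :: "rat mat"
  assumes A: "A \<in> carrier_mat u v"
  obtains B where "B \<in> carrier_mat v u" "A * B * A = A"
proof -
  define sc where "sc = (\<lambda>(a::rat) (f::nat \<Rightarrow> rat) i. a * f i)"
  interpret vector_space_pair sc sc
    by unfold_locales (auto simp: sc_def fun_eq_iff algebra_simps)
  \<comment> \<open>Vectors are functions on all naturals: \<open>f\<close> reads only coordinates
    below \<open>v\<close> and is zero from \<open>u\<close> on, so its values are combinations of
    the \<open>e l\<close> with \<open>l < u\<close>.\<close>
  define f where "f x = (\<lambda>i. if i < u then \<Sum>k<v. A $$ (i,k) * x k else 0)" for x :: "nat \<Rightarrow> rat"
  have "Vector_Spaces.linear sc sc f"
    by unfold_locales
      (auto simp: f_def sc_def fun_eq_iff algebra_simps sum.distrib sum_distrib_left)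
  then obtain g where g: "Vector_Spaces.linear sc sc g" "\<And>w. w \<in> range f \<Longrightarrow> f (g w) = w"
    using linear_exists_right_inverse_on[of f UNIV] vs1.subspace_UNIV by blast
  interpret g: Vector_Spaces.linear sc sc g by (rule g)
  define e where "e k = (\<lambda>i. if i = k then 1 else 0 :: rat)" for k :: nat
  define B where "B = mat v u (\<lambda>(k,l). g (e l) k)"
  have B: "B \<in> carrier_mat v u" by (simp add: B_def)
  have "A * B * A = A"
  proof (rule eq_matI)
    fix i k assume "i < dim_row A" "k < dim_col A"
    then have ik: "i < u" "k < v" using A by auto
    have fe: "f (e k) = (\<Sum>l<u. sc (A $$ (l,k)) (e l))"
    proof
      fix j
      have "(\<Sum>l<u. sc (A $$ (l,k)) (e l)) j = (\<Sum>l<u. A $$ (l,k) * e l j)"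
        by (induction u) (auto simp: sc_def)
      then show "f (e k) j = (\<Sum>l<u. sc (A $$ (l,k)) (e l)) j"
        using ik by (auto simp: f_def e_def if_distrib cong: if_cong)
    qed
    have ge: "g (f (e k)) m = (\<Sum>l<u. A $$ (l,k) * g (e l) m)" for m
    proof -
      have "g (f (e k)) m = (\<Sum>l<u. sc (A $$ (l,k)) (g (e l))) m"
        by (simp add: fe g.sum g.scale)
      also have "\<dots> = (\<Sum>l<u. A $$ (l,k) * g (e l) m)"
        by (induction u) (auto simp: sc_def)
      finally show ?thesis .
    qed
    have "A * B * A = A * (B * A)" using A B by (simp add: assoc_mult_mat)
    then have "(A * B * A) $$ (i,k) = (\<Sum>m<v. A $$ (i,m) * (\<Sum>l<u. g (e l) m * A $$ (l,k)))"
      using A B ik by (simp add: scalar_prod_def B_def atLeast0LessThan)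
    also have "\<dots> = f (g (f (e k))) i"
      using ik by (simp add: f_def[of "g _"] ge mult.commute)
    also have "\<dots> = f (e k) i" using g(2) by simp
    also have "\<dots> = A $$ (i,k)" using ik by (simp add: f_def e_def if_distrib cong: if_cong)
    finally show "(A * B * A) $$ (i,k) = A $$ (i,k)" .
  qed (use A B in auto)
  with B that show ?thesis by blast
qed

text \<open>\<open>A * B\<close> is a projection onto the column space of \<open>A\<close>, so the
  kernel of its complement is that space. Since \<open>A\<close> is nonzero, so is the projection,
  which allows one equation to be dropped.\<close>

lemma column_space_as_kernel:
  fixes A :: "rat mat"
  assumes A: "A \<in> carrier_mat u v" and nz: "A \<noteq> 0\<^sub>m u v"
  obtains B N where "B \<in> carrier_mat v u" "N \<in> carrier_mat (u - 1) u"
    "\<And>y. y \<in> carrier_vec v \<Longrightarrow> N *\<^sub>v (A *\<^sub>v y) = 0\<^sub>v (u - 1)"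
    "\<And>a. a \<in> carrier_vec u \<Longrightarrow> N *\<^sub>v a = 0\<^sub>v (u - 1) \<Longrightarrow> A *\<^sub>v (B *\<^sub>v a) = a"
proof -
  obtain B where B: "B \<in> carrier_mat v u" and ABA: "A * B * A = A"
    using generalised_inverse_exists[OF A] .
  define Q where "Q = A * B"
  have Q: "Q \<in> carrier_mat u u" using A B by (simp add: Q_def)
  have "Q \<noteq> 0\<^sub>m u u" using ABA nz A by (auto simp: Q_def)
  then obtain i k where ik: "i < u" "k < u" "Q $$ (i,k) \<noteq> 0"
    using Q by (metis carrier_matD eq_matI index_zero_mat)
  have QQ: "Q *\<^sub>v (Q *\<^sub>v a) = Q *\<^sub>v a" if "a \<in> carrier_vec u" for a
  proof -
    have "Q * Q = A * B * A * B"
      unfolding Q_def using assoc_mult_mat[of "A * B" u u A v B u] A B by simp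
    then have "Q * Q = Q" by (simp add: ABA Q_def)
    then show ?thesis using assoc_mult_mat_vec[OF Q Q that] by simp
  qed
  \<comment> \<open>Row \<open>k\<close> of the projection \<open>1 - Q\<close> is redundant because \<open>Q (1 - Q) = 0\<close> and \<open>Q\<close> has
    a nonzero entry in column \<open>k\<close>.\<close>
  define \<sigma> where "\<sigma> r = (if r < k then r else Suc r)" for r
  define N where "N = mat (u - 1) u (\<lambda>(r,l). (if l = \<sigma> r then 1 else 0) - Q $$ (\<sigma> r, l))"
  have N: "N \<in> carrier_mat (u - 1) u" by (simp add: N_def)
  have \<sigma>: "\<sigma> r < u" if "r < u - 1" for r using that ik by (auto simp: \<sigma>_def)
  have Na: "(N *\<^sub>v a) $ r = a $ \<sigma> r - (Q *\<^sub>v a) $ \<sigma> r" if "r < u - 1" "a \<in> carrier_vec u" for a r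
    using that \<sigma>[OF that(1)] Q
    by (auto simp: N_def scalar_prod_def left_diff_distrib sum_subtractf if_distrib[of "\<lambda>x. x * _"] cong: if_cong)
  show ?thesis
  proof (rule that[OF B N])
    fix y :: "rat vec" assume y: "y \<in> carrier_vec v"
    have "Q *\<^sub>v (A *\<^sub>v y) = (Q * A) *\<^sub>v y" using assoc_mult_mat_vec[OF Q A y] by simp
    then have "Q *\<^sub>v (A *\<^sub>v y) = A *\<^sub>v y" by (simp add: Q_def ABA)
    then show "N *\<^sub>v (A *\<^sub>v y) = 0\<^sub>v (u - 1)"
      using A y N by (intro eq_vecI) (auto simp: Na simp del: index_mult_mat_vec)
  next
    fix a :: "rat vec" assume a: "a \<in> carrier_vec u" and 0: "N *\<^sub>v a = 0\<^sub>v (u - 1)"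
    have eq: "a $ l = (Q *\<^sub>v a) $ l" if l: "l < u" "l \<noteq> k" for l
    proof -
      define r where "r = (if l < k then l else l - 1)"
      have "r < u - 1" "\<sigma> r = l" using l ik by (auto simp: r_def \<sigma>_def)
      then show ?thesis using Na[OF _ a, of r] 0 by simp
    qed
    \<comment> \<open>\<open>z\<close> is supported at \<open>k\<close> and killed by
      \<open>Q\<close>; row \<open>i\<close> of \<open>Q *\<^sub>v z = 0\<^sub>v u\<close> then
      forces \<open>z $ k = 0\<close>.\<close>
    define z where "z = a - Q *\<^sub>v a"
    have z: "z \<in> carrier_vec u" using a Q by (simp add: z_def)
    have z0: "z $ l = 0" if "l < u" "l \<noteq> k" for l using eq[OF that] that a Q by (simp add: z_def)
    have "Q *\<^sub>v z = 0\<^sub>v u" using a Q QQ[OF a]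
      by (simp add: z_def mult_minus_distrib_mat_vec[of _ u u])
    then have "(\<Sum>l<u. Q $$ (i,l) * z $ l) = 0"
      using ik Q z by (metis (no_types, lifting) atLeast0LessThan carrier_matD carrier_vecD index_mult_mat_vec index_row(1) index_zero_vec(1) lessThan_iff scalar_prod_def sum.cong)
    moreover have "(\<Sum>l<u. Q $$ (i,l) * z $ l) = Q $$ (i,k) * z $ k"
      using ik z0 by (subst sum.remove[of _ k]) (auto intro!: sum.neutral)
    ultimately have "z $ k = 0" using ik by simp
    then have "a $ k = (Q *\<^sub>v a) $ k" using ik a Q by (simp add: z_def)
    then have "Q *\<^sub>v a = a" using eq a Q by (intro eq_vecI) (auto simp del: index_mult_mat_vec, metis)
    then show "A *\<^sub>v (B *\<^sub>v a) = a" using assoc_mult_mat_vec[OF A B a] by (simp add: Q_def)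
  qed
qed


section \<open>The matrix \<open>D\<close> and its kernel\<close>

text \<open>For \<open>N\<close> of size \<open>j \<times> u\<close> and \<open>s = (a, b, c)\<close> split into blocks of length \<open>u\<close>,
  the system says \<open>N a = 0\<close> and \<open>a = d (b - c)\<close>.\<close>

definition difference_extension :: "rat \<Rightarrow> rat mat \<Rightarrow> rat mat" where
  "difference_extension d N = mat (dim_row N + dim_col N) (3 * dim_col N) (\<lambda>(r, l).
     if r < dim_row N then if l < dim_col N then N $$ (r, l) else 0
     else of_bool (l = r - dim_row N)
       - d * of_bool (l = dim_col N + (r - dim_row N))
       + d * of_bool (l = 2 * dim_col N + (r - dim_row N)))"

lemma difference_extension_carrier:
  "N \<in> carrier_mat j u \<Longrightarrow> difference_extension d N \<in> carrier_mat (j + u) (3 * u)"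
  by (auto simp: difference_extension_def)

lemma difference_extension_kernel_iff:
  assumes N: "N \<in> carrier_mat j u" and s: "s \<in> carrier_vec (3 * u)"
  shows "difference_extension d N *\<^sub>v s = 0\<^sub>v (j + u) \<longleftrightarrow>
    N *\<^sub>v vec u (\<lambda>i. s $ i) = 0\<^sub>v j \<and>
    (\<forall>i<u. s $ i = d * (s $ (u + i) - s $ (2 * u + i)))"
proof -
  let ?D = "difference_extension d N"
  have D: "?D \<in> carrier_mat (j + u) (3 * u)" by (rule difference_extension_carrier[OF N])
  have upper: "(?D *\<^sub>v s) $ r = (N *\<^sub>v vec u (\<lambda>i. s $ i)) $ r" if r: "r < j" for r
  proof -
    have "(?D *\<^sub>v s) $ r = (\<Sum>l<3*u. (if l < u then N $$ (r,l) else 0) * s $ l)"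
      using r N s by (simp add: difference_extension_def scalar_prod_def atLeast0LessThan)
    also have "\<dots> = (\<Sum>l<u. N $$ (r,l) * s $ l)"
      by (rule sum.mono_neutral_cong_right) auto
    finally show ?thesis using r N by (simp add: scalar_prod_def atLeast0LessThan)
  qed
  have lower: "(?D *\<^sub>v s) $ (j + i) = s $ i - d * (s $ (u + i) - s $ (2 * u + i))"
    if i: "i < u" for i
  proof -
    have "(?D *\<^sub>v s) $ (j + i) = (\<Sum>l<3*u. (of_bool (l = i) - d * of_bool (l = u + i)
        + d * of_bool (l = 2 * u + i)) * s $ l)"
      using i N s by (simp add: difference_extension_def scalar_prod_def atLeast0LessThan)
    also have "\<dots> = (\<Sum>l<3*u. if l = i then s $ l else 0)
        - (\<Sum>l<3*u. if l = u + i then d * s $ l else 0)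
        + (\<Sum>l<3*u. if l = 2 * u + i then d * s $ l else 0)"
      unfolding sum_subtractf[symmetric] sum.distrib[symmetric]
      by (intro sum.cong) auto
    also have "\<dots> = s $ i - d * (s $ (u + i) - s $ (2 * u + i))"
      using i by (simp add: algebra_simps)
    finally show ?thesis .
  qed
  have split: "(\<forall>r<j+u. P r) \<longleftrightarrow> (\<forall>r<j. P r) \<and> (\<forall>i<u. P (j + i))" for P
    by (metis add_diff_inverse_nat nat_add_left_cancel_less trans_less_add1)
  have "?D *\<^sub>v s = 0\<^sub>v (j + u) \<longleftrightarrow> (\<forall>r<j+u. (?D *\<^sub>v s) $ r = 0)"
    using D by (metis carrier_matD(1) dim_mult_mat_vec eq_vecI index_zero_vec)
  also have "\<dots> \<longleftrightarrow> (\<forall>r<j. (N *\<^sub>v vec u (\<lambda>i. s $ i)) $ r = 0) \<and>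
      (\<forall>i<u. s $ i - d * (s $ (u + i) - s $ (2 * u + i)) = 0)"
    unfolding split using upper lower by simp
  also have "(\<forall>r<j. (N *\<^sub>v vec u (\<lambda>i. s $ i)) $ r = 0) \<longleftrightarrow> N *\<^sub>v vec u (\<lambda>i. s $ i) = 0\<^sub>v j"
    using N by (metis carrier_matD(1) dim_mult_mat_vec eq_vecI index_zero_vec)
  finally show ?thesis by simp
qed

lemma rat_additive_subgroup_closed:
  assumes S: "additive_subgroup S (class_ring :: rat ring)"
  shows "0 \<in> S" "x \<in> S \<Longrightarrow> y \<in> S \<Longrightarrow> x + y \<in> S" "x \<in> S \<Longrightarrow> of_int n * x \<in> S"
proof -
  interpret additive_subgroup S "class_ring :: rat ring" by (rule S)
  show 0: "0 \<in> S" using zero_closed by (simp add: class_ring_simps)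
  show add: "x + y \<in> S" if "x \<in> S" "y \<in> S" for x y
    using a_closed[OF that] by (simp add: class_ring_simps)
  have neg: "- x \<in> S" if "x \<in> S" for x
    using a_inv_closed[OF that] by (simp add: class_ring_simps)
  have nat: "of_nat m * x \<in> S" if "x \<in> S" for m x
    by (induction m) (auto simp: 0 distrib_right intro: add that)
  show "of_int n * x \<in> S" if "x \<in> S" for x
    using nat[OF that] neg[OF nat[OF that]] by (cases n rule: int_cases2) auto
qed

section \<open>Kernel partition regularity of \<open>D\<close>\<close>

lemma difference_extension_kernel_partition_regular:
  assumes S: "additive_subgroup S (class_ring :: rat ring)"
    and A: "A \<in> carrier_mat u v" and N: "N \<in> carrier_mat j u"
    and NA: "\<And>y. y \<in> carrier_vec v \<Longrightarrow> N *\<^sub>v (A *\<^sub>v y) = 0\<^sub>v j"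
    and wipr: "weakly_image_partition_regular A S"
    and d: "d > 0"
  shows "kernel_partition_regular (difference_extension (of_nat d) N) S"
  unfolding kernel_partition_regular_def
proof (intro allI impI)
  let ?D = "difference_extension (of_nat d) N"
  have D: "?D \<in> carrier_mat (j + u) (3 * u)" by (rule difference_extension_carrier[OF N])
  have S_mult: "of_nat n * x \<in> S - {0}" if "n > 0" "x \<in> S - {0}" for n x
    using rat_additive_subgroup_closed(3)[OF S, of x "int n"] that by simp
  fix c assume c: "finite_colouring c (S - {0})"
  then obtain r where r: "c ` (S - {0}) \<subseteq> {..<r}"
    unfolding finite_colouring_def using finite_nat_iff_bounded by blast
  define \<A> where "\<A> = {set\<^sub>v (A *\<^sub>v x) | x. x \<in> vecs_over S v \<and> set\<^sub>v (A *\<^sub>v x) \<subseteq> S - {0}}"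
  have "\<exists>E\<in>\<A>. \<exists>k. \<forall>e\<in>E. c' e = k" if c': "c' ` (S - {0}) \<subseteq> {..<r}" for c'
  proof -
    have "finite_colouring c' (S - {0})"
      using c' finite_subset unfolding finite_colouring_def by blast
    then obtain x where "x \<in> vecs_over S v" "set\<^sub>v (A *\<^sub>v x) \<subseteq> S - {0}"
      "monochromatic c' (set\<^sub>v (A *\<^sub>v x))"
      using wipr A unfolding weakly_image_partition_regular_def by auto
    then show ?thesis unfolding \<A>_def monochromatic_def by blast
  qed
  moreover have "finite E \<and> E \<subseteq> S - {0}" if "E \<in> \<A>" for E
    using that by (auto simp: \<A>_def vec_set_def)
  ultimately obtain F where F: "finite F" "F \<subseteq> S - {0}"
    and F_mono: "\<And>c. c ` F \<subseteq> {..<r} \<Longrightarrow> \<exists>E\<in>\<A>. E \<subseteq> F \<and> (\<exists>k. \<forall>e\<in>E. c e = k)"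
    using colouring_compactness[of \<A> "S - {0}" r] by metis
  \<comment> \<open>Recording the colours of all dilates of \<open>F\<close> makes one pattern \<open>x, x + t, d t\<close> serve
    every element of \<open>F\<close> simultaneously.\<close>
  define c' where "c' n = restrict (\<lambda>f. c (of_nat n * f)) F" for n :: nat
  have "c' ` {0<..} \<subseteq> F \<rightarrow>\<^sub>E {..<r}"
  proof
    fix g assume "g \<in> c' ` {0<..}"
    then obtain n where n: "n > 0" "g = c' n" by auto
    have "c (of_nat n * f) < r" if "f \<in> F" for f
      using S_mult[OF n(1), of f] F(2) r that by blast
    then show "g \<in> F \<rightarrow>\<^sub>E {..<r}" by (auto simp: n(2) c'_def)
  qed
  then have "finite (c' ` {0<..})" by (rule finite_subset) (simp add: F(1) finite_PiE)
  then obtain x t where xt: "x > 0" "t > 0" "c' (x + t) = c' x" "c' (d * t) = c' x"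
    using finite_colouring_dilated_difference d by blast
  have same: "c (of_nat (x + t) * f) = c (of_nat x * f)" "c (of_nat (d * t) * f) = c (of_nat x * f)"
    if "f \<in> F" for f
    using fun_cong[OF xt(3), of f] fun_cong[OF xt(4), of f] that by (simp_all add: c'_def)
  have "(\<lambda>f. c (of_nat x * f)) ` F \<subseteq> {..<r}"
    using S_mult[OF xt(1)] F(2) r by blast
  from F_mono[OF this] obtain y k where y: "y \<in> vecs_over S v" "set\<^sub>v (A *\<^sub>v y) \<subseteq> F"
    and k: "\<And>e. e \<in> set\<^sub>v (A *\<^sub>v y) \<Longrightarrow> c (of_nat x * e) = k"
    by (auto simp: \<A>_def)
  define a where "a = A *\<^sub>v y"
  have y': "y \<in> carrier_vec v" using y(1) by (simp add: vecs_over_def)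
  have a: "a \<in> carrier_vec u" using A y' by (simp add: a_def)
  \<comment> \<open>Multipliers of the three blocks of \<open>s\<close>, chosen so that the first
    equals \<open>d\<close> times the difference of the other two.\<close>
  define m where "m b = (if b = 0 then d * t else if b = 1 then x + t else x)" for b :: nat
  define s where "s = vec (3 * u) (\<lambda>i. of_nat (m (i div u)) * a $ (i mod u))"
  have s: "s \<in> carrier_vec (3 * u)" by (simp add: s_def)
  have m: "m b > 0" for b using xt d by (simp add: m_def)
  have aF: "a $ i \<in> F" "c (of_nat x * a $ i) = k" if "i < u" for i
    using that a y(2) k by (auto simp: a_def[symmetric] vec_set_def)
  have s_in: "s $ i \<in> S - {0} \<and> c (s $ i) = k" if i: "i < 3 * u" for i
  proof -
    have "i mod u < u" using i by (intro mod_less_divisor) (cases u, auto)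
    note aF' = aF[OF this]
    have "c (of_nat (m b) * a $ (i mod u)) = k" for b
      using aF' same[OF aF'(1)] by (simp add: m_def del: of_nat_add of_nat_mult)
    moreover have "of_nat (m b) * a $ (i mod u) \<in> S - {0}" for b
      using aF'(1) F(2) by (intro S_mult[OF m]) blast
    ultimately show ?thesis using i by (simp add: s_def)
  qed
  have s_upper: "s $ i = of_nat (d * t) * a $ i" "s $ (u + i) = of_nat (x + t) * a $ i"
    "s $ (2 * u + i) = of_nat x * a $ i" if "i < u" for i
    using that by (simp_all add: s_def m_def div_add1_eq)
  \<comment> \<open>A dilate of an image of \<open>A\<close> is again an image, so \<open>N\<close>
    annihilates the first block.\<close>
  have "vec u (\<lambda>i. s $ i) = A *\<^sub>v (of_nat (d * t) \<cdot>\<^sub>v y)"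
    using a y' A s_upper(1) by (subst mult_mat_vec[OF A y']) (auto simp: a_def[symmetric])
  then have "N *\<^sub>v vec u (\<lambda>i. s $ i) = 0\<^sub>v j" using NA y' by simp
  then have "?D *\<^sub>v s = 0\<^sub>v (j + u)"
    using s_upper by (subst difference_extension_kernel_iff[OF N s]) (simp add: algebra_simps)
  moreover have "s \<in> vecs_over (S - {0}) (3 * u)"
    using s s_in by (auto simp: vecs_over_def vec_set_def)
  moreover have "monochromatic c (set\<^sub>v s)"
    using s s_in by (auto simp: monochromatic_def vec_set_def)
  ultimately show "\<exists>x\<in>vecs_over (S - {0}) (dim_col ?D).
      ?D *\<^sub>v x = 0\<^sub>v (dim_row ?D) \<and> monochromatic c (set\<^sub>v x)"
    using D by auto
qed

section \<open>Recovering an image of \<open>A\<close> from a kernel vector of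
  \<open>D\<close>\<close>

theorem theorem2p11:
  fixes S :: "rat set" and u v :: nat and A :: "rat mat"
  assumes "additive_subgroup S (class_ring :: rat ring)"
    and "S \<noteq> {0}" and "S \<noteq> UNIV"
    and "u > 0" and "v > 0"
    and "A \<in> carrier_mat u v"
    and "weakly_image_partition_regular A S"
    and "rows_linearly_dependent A"
  shows "\<exists>j D. 0 < j \<and> j < u \<and> D \<in> carrier_mat (j + u) (3 * u) \<and>
           kernel_partition_regular D S \<and>
           (\<forall>s \<in> vecs_over (S - {0}) (3 * u). D *\<^sub>v s = 0\<^sub>v (j + u) \<longrightarrow>
              (\<exists>y \<in> vecs_over S v - {0\<^sub>v v}. set\<^sub>v (A *\<^sub>v y) \<subseteq> set\<^sub>v s))"
proof -
  note S = assms(1) and u = assms(4) and A = assms(6) and wipr = assms(7)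
  note S_closed = rat_additive_subgroup_closed[OF S]
  have nz: "A \<noteq> 0\<^sub>m u v"
  proof
    assume A0: "A = 0\<^sub>m u v"
    \<comment> \<open>A single colour already yields an image with nonzero entries.\<close>
    have "finite_colouring (\<lambda>_. 0) (S - {0})"
      unfolding finite_colouring_def by (rule finite_subset[of _ "{0}"]) auto
    then obtain x where "x \<in> vecs_over S v" and x: "set\<^sub>v (A *\<^sub>v x) \<subseteq> S - {0}"
      using wipr A unfolding weakly_image_partition_regular_def by auto
    then have "A *\<^sub>v x = 0\<^sub>v u" by (intro eq_vecI) (auto simp: A0 vecs_over_def)
    then have "0 \<in> set\<^sub>v (A *\<^sub>v x)" using u by (auto simp: vec_set_def)
    with x show False by blast
  qed
  \<comment> \<open>Dependence of the rows gives \<open>j = u - 1 > 0\<close>: a single dependent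
    row would be zero.\<close>
  have u2: "u > 1"
  proof (rule ccontr)
    assume "\<not> u > 1"
    then have u1: "u = 1" using u by simp
    from assms(8) have "\<forall>k<v. A $$ (0,k) = 0"
      using A by (auto simp: rows_linearly_dependent_def u1)
    then have "A = 0\<^sub>m u v" using A u1 by (intro eq_matI) auto
    with nz show False by simp
  qed
  obtain B N where B: "B \<in> carrier_mat v u" and N: "N \<in> carrier_mat (u - 1) u"
    and NA: "\<And>y. y \<in> carrier_vec v \<Longrightarrow> N *\<^sub>v (A *\<^sub>v y) = 0\<^sub>v (u - 1)"
    and AB: "\<And>a. a \<in> carrier_vec u \<Longrightarrow> N *\<^sub>v a = 0\<^sub>v (u - 1) \<Longrightarrow> A *\<^sub>v (B *\<^sub>v a) = a"
    using column_space_as_kernel[OF A nz] by metis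
  obtain d where d: "d > 0" "\<And>k i. k < v \<Longrightarrow> i < u \<Longrightarrow> of_nat d * B $$ (k,i) \<in> \<int>"
  proof -
    have "finite ((\<lambda>p. B $$ p) ` ({..<v} \<times> {..<u}))" by simp
    then show ?thesis by (rule common_denominator) (auto intro!: that)
  qed
  define D where "D = difference_extension (of_nat d) N"
  have "\<exists>y\<in>vecs_over S v - {0\<^sub>v v}. set\<^sub>v (A *\<^sub>v y) \<subseteq> set\<^sub>v s"
    if s: "s \<in> vecs_over (S - {0}) (3 * u)" and Ds: "D *\<^sub>v s = 0\<^sub>v (u - 1 + u)" for s
  proof -
    have s': "s \<in> carrier_vec (3 * u)" using s by (simp add: vecs_over_def)
    have sS: "s $ i \<in> S - {0}" if "i < 3 * u" for i
      using s that by (auto simp: vecs_over_def vec_set_def image_subset_iff)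
    define a where "a = vec u (\<lambda>i. s $ i)"
    define y where "y = B *\<^sub>v a"
    have a: "a \<in> carrier_vec u" by (simp add: a_def)
    have y: "y \<in> carrier_vec v" using B a by (simp add: y_def)
    have "N *\<^sub>v a = 0\<^sub>v (u - 1)"
      and diff: "\<And>i. i < u \<Longrightarrow> s $ i = of_nat d * (s $ (u + i) - s $ (2 * u + i))"
      using Ds unfolding D_def difference_extension_kernel_iff[OF N s'] a_def by auto
    then have Ay: "A *\<^sub>v y = a" using AB a by (simp add: y_def)
    have sum_S: "(\<Sum>i\<in>I. g i) \<in> S" if "finite I" "\<And>i. i \<in> I \<Longrightarrow> g i \<in> S" for I :: "nat set" and g
      using that by induction (auto intro: S_closed)
    have "y $ k \<in> S" if k: "k < v" for k
    proof -
      \<comment> \<open>The entries of \<open>B\<close> need not map \<open>S\<close> into itself.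
        Writing \<open>a\<close> as \<open>d\<close> times a difference makes the coefficients
        integers.\<close>
      have "y $ k = (\<Sum>i<u. (of_nat d * B $$ (k,i)) * (s $ (u + i) - s $ (2 * u + i)))"
        using k B diff by (simp add: y_def a_def scalar_prod_def atLeast0LessThan mult_ac)
      also have "\<dots> \<in> S"
      proof (rule sum_S)
        fix i assume "i \<in> {..<u}"
        then have i: "i < u" by simp
        obtain n where n: "of_nat d * B $$ (k,i) = of_int n" using d(2)[OF k i] by (auto elim: Ints_cases)
        have "s $ (u + i) - s $ (2 * u + i) \<in> S"
          using S_closed(2)[of "s $ (u + i)" "of_int (- 1) * s $ (2 * u + i)"]
            S_closed(3)[of "s $ (2 * u + i)" "- 1"] sS[of "u + i"] sS[of "2 * u + i"] i by simp
        then show "of_nat d * B $$ (k,i) * (s $ (u + i) - s $ (2 * u + i)) \<in> S"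
          unfolding n by (rule S_closed(3))
      qed simp
      finally show ?thesis .
    qed
    then have "y \<in> vecs_over S v" using y by (auto simp: vecs_over_def vec_set_def)
    moreover have "y \<noteq> 0\<^sub>v v"
    proof
      assume "y = 0\<^sub>v v"
      \<comment> \<open>The image \<open>a\<close> of \<open>y\<close> consists of entries of
        \<open>s\<close>, which are nonzero.\<close>
      then have "a = 0\<^sub>v u" using A unfolding Ay[symmetric] by (intro eq_vecI) auto
      then have "s $ 0 = 0" using u by (metis a_def index_vec index_zero_vec(1))
      with sS[of 0] u show False by simp
    qed
    moreover have "set\<^sub>v (A *\<^sub>v y) \<subseteq> set\<^sub>v s"
      using s' by (auto simp: Ay a_def vec_set_def)
    ultimately show ?thesis by blast
  qed
  moreover have "kernel_partition_regular D S"
    unfolding D_def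
    by (rule difference_extension_kernel_partition_regular[OF S A N NA wipr d(1)])
  moreover have "D \<in> carrier_mat (u - 1 + u) (3 * u)"
    unfolding D_def by (rule difference_extension_carrier[OF N])
  ultimately show ?thesis using u2 by (intro exI[of _ "u - 1"] exI[of _ D]) simp
qed

end
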